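(* Assume $$k_{21}+2k_{11}=3k_{11}=:\rho_{11},\quad k_{22}+2k_{12}=3k_{12}=:\rho_{12},\quad k_{11}+2k_{21}=3k_{21}=:\rho_{21},\quad k_{12}+2k_{22}=3k_{22}=:\rho_{22}.$$ Consider the random (stopping) time $$\tau^*:=\inf\Big\{t\ge0:\int_0^t\min\big\{e^{\rho_{11}W(s)+\rho_{12}B^H(s)},\,e^{\rho_{21}W(s)+\rho_{22}B^H(s)}\big\}\,e^{3(\chi+k^2)s}\,ds\ge\frac{E^3(0)}{12\tilde\lambda}\Big\},$$ where $\tilde\lambda:=\min\{\lambda_{11}+\lambda_{22},\lambda_{12}+\lambda_{21}\}$, $k^2:=\min\{\frac{k_{11}^2}{2},\frac{k_{21}^2}{2}\}$ and $E(0):=\int_D[g_1(x)+g_2(x)]\psi(x)dx$. Then, on the event $\{\tau^*<\infty\}$, the solution $v=(v_1,v_2)^\top$ of the system (V) of the context, and thus the solution $z=(z_1,z_2)^\top$ of the system (Z) of the context, quenches in finite time $\tau_q\le\tau^*$, $\mathbb P$-a.s.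
   Context: $D\subset\mathbb{R}^d$, $d\ge1$, is a bounded domain with smooth boundary $\partial D$ and outward unit normal $\nu$. The constants $\beta$, $\lambda_{i1},\lambda_{i2}$, $k_{i1},k_{i2}$ ($i=1,2$) are positive. On a filtered probability space $(\Omega,\mathcal F,(\mathcal F_t)_{t\ge0},\mathbb P)$, $W$ is a standard one-dimensional Brownian motion and $B^H$ is a one-dimensional fractional Brownian motion with Hurst index $H\in(1/2,1)$; $N_i(t):=k_{i1}W(t)+k_{i2}B^H(t)$. $g_i=1-f_i$ with $f_i\in C^2(D)$, $0\le f_i<1$, $f_i\not\equiv0$, so $0<g_i\le1$. Throughout $i=1,2$ and $j\in\{1,2\}\setminus\{i\}$. $(\chi,\psi)$ is the principal eigenpair of $-\Delta\psi=\chi\psi$ in $D$, $\frac{\partial\psi}{\partial\nu}+\beta\psi=0$ on $\partial D$, with $\chi>0$, $\psi>0$ and $\int_D\psi\,dx=1$. System (Z): $dz_i=[\Delta z_i-\lambda_{i1}z_i^{-2}-\lambda_{i2}z_j^{-2}]dt-z_i\,dN_i(t)$ for $t>0,\ x\in D$ (Itô integral for $W$, pathwise Young integral for $B^H$); $\frac{\partial z_i}{\partial\nu}+\beta z_i=0$ on $\partial D$, $t>0$; $z_i(0,x)=g_i(x)$, $x\in D$. System (V), obtained from (Z) by $v_i=e^{N_i(t)}z_i$: $\frac{\partial v_i}{\partial t}=(\Delta-\frac{k_{i1}^2}{2})v_i-\lambda_{i1}v_i^{-2}e^{3N_i(t)}-\lambda_{i2}v_j^{-2}e^{N_i(t)+2N_j(t)}$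 for $t>0,\ x\in D$; $\frac{\partial v_i}{\partial\nu}+\beta v_i=0$ on $\partial D$, $t>0$; $v_i(0,x)=g_i(x)$, $x\in D$. The solution $v$ is understood in the weak sense (equivalently mild): for every $\varphi_i\in C^2(D)$ with $\frac{\partial\varphi_i}{\partial\nu}+\beta\varphi_i=0$ on $\partial D$ and $t<\tau_q$, $\int_Dv_i(t)\varphi_i=\int_Dg_i\varphi_i+\int_0^t\int_Dv_i(s)(\Delta-\frac{k_{i1}^2}{2})\varphi_i\,ds-\lambda_{i1}\int_0^te^{3N_i(s)}\int_Dv_i^{-2}(s)\varphi_i\,ds-\lambda_{i2}\int_0^te^{N_i(s)+2N_j(s)}\int_Dv_j^{-2}(s)\varphi_i\,ds$. The quenching time $\tau_q$ (common to $v$ and $z$) is the stopping time such that $\lim_{t\to\tau_q}\min\{\min_{\bar D}|z_1(t,\cdot)|,\min_{\bar D}|z_2(t,\cdot)|\}=0$ a.s. on $\{\tau_q<\infty\}$; the solution is global if $\tau_q=\infty$. Infimum of the empty set is $+\infty$. *)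

theory Defs
  imports "HOL-Probability.Probability"
begin

section \<open>Differential calculus on domains\<close>

definition partial_deriv :: "'a::euclidean_space \<Rightarrow> ('a \<Rightarrow> real) \<Rightarrow> 'a \<Rightarrow> real" where
  "partial_deriv b f x = frechet_derivative f (at x) b"

definition gradient :: "('a::euclidean_space \<Rightarrow> real) \<Rightarrow> 'a \<Rightarrow> 'a" where
  "gradient f x = (\<Sum>b\<in>Basis. partial_deriv b f x *\<^sub>R b)"

definition laplacian :: "('a::euclidean_space \<Rightarrow> real) \<Rightarrow> 'a \<Rightarrow> real" where
  "laplacian f x = (\<Sum>b\<in>Basis. partial_deriv b (partial_deriv b f) x)"

text \<open>\<open>C_on n f S\<close>: \<open>f\<close> is of class \<open>C\<^sup>n\<close> on \<open>S\<close>. It is only used for open \<open>S\<close>.\<close>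

primrec C_on :: "nat \<Rightarrow> ('a::euclidean_space \<Rightarrow> real) \<Rightarrow> 'a set \<Rightarrow> bool" where
  "C_on 0 f S \<longleftrightarrow> continuous_on S f"
| "C_on (Suc n) f S \<longleftrightarrow> (\<forall>x\<in>S. f differentiable (at x)) \<and> (\<forall>b\<in>Basis. C_on n (partial_deriv b f) S)"

text \<open>
  Class \<open>C\<^sup>2\<close> up to the boundary, for functions whose normal derivative is taken on the
  boundary. For a bounded domain with smooth boundary this is the usual \<open>C\<^sup>2\<close> on the closure
  (every such function extends to a \<open>C\<^sup>2\<close> function near the closure).
\<close>

definition C2_closure :: "'a::euclidean_space set \<Rightarrow> ('a \<Rightarrow> real) \<Rightarrow> bool" where
  "C2_closure D f \<longleftrightarrow> (\<exists>U. open U \<and> closure D \<subseteq> U \<and> C_on 2 f U)"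

text \<open>
  \<open>D\<close> is \<open>{\<rho> < 0}\<close> near the boundary point \<open>p\<close>, with \<open>\<rho>\<close> smooth and without critical points.
\<close>

definition local_defining_function ::
  "'a::euclidean_space set \<Rightarrow> 'a \<Rightarrow> 'a set \<Rightarrow> ('a \<Rightarrow> real) \<Rightarrow> bool" where
  "local_defining_function D p U \<rho> \<longleftrightarrow>
     open U \<and> p \<in> U \<and> (\<forall>n. C_on n \<rho> U) \<and> (\<forall>x\<in>U. gradient \<rho> x \<noteq> 0) \<and> (\<forall>x\<in>U. x \<in> D \<longleftrightarrow> \<rho> x < 0)"

definition bounded_smooth_domain :: "'a::euclidean_space set \<Rightarrow> bool" where
  "bounded_smooth_domain D \<longleftrightarrow>
     open D \<and> connected D \<and> D \<noteq> {} \<and> bounded D \<and>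
     (\<forall>p\<in>frontier D. \<exists>U \<rho>. local_defining_function D p U \<rho>)"

definition outward_unit_normal :: "'a::euclidean_space set \<Rightarrow> ('a \<Rightarrow> 'a) \<Rightarrow> bool" where
  "outward_unit_normal D \<nu> \<longleftrightarrow>
     (\<forall>p\<in>frontier D. \<exists>U \<rho>. local_defining_function D p U \<rho> \<and>
        \<nu> p = (1 / norm (gradient \<rho> p)) *\<^sub>R gradient \<rho> p)"

definition robin_condition ::
  "'a::euclidean_space set \<Rightarrow> ('a \<Rightarrow> 'a) \<Rightarrow> real \<Rightarrow> ('a \<Rightarrow> real) \<Rightarrow> bool" where
  "robin_condition D \<nu> \<beta> \<phi> \<longleftrightarrow>
     (\<forall>p\<in>frontier D. frechet_derivative \<phi> (at p) (\<nu> p) + \<beta> * \<phi> p = 0)"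

definition robin_test_functions ::
  "'a::euclidean_space set \<Rightarrow> ('a \<Rightarrow> 'a) \<Rightarrow> real \<Rightarrow> ('a \<Rightarrow> real) set" where
  "robin_test_functions D \<nu> \<beta> = {\<phi>. C2_closure D \<phi> \<and> robin_condition D \<nu> \<beta> \<phi>}"

definition robin_eigenpair ::
  "'a::euclidean_space set \<Rightarrow> ('a \<Rightarrow> 'a) \<Rightarrow> real \<Rightarrow> real \<Rightarrow> ('a \<Rightarrow> real) \<Rightarrow> bool" where
  "robin_eigenpair D \<nu> \<beta> chi \<psi> \<longleftrightarrow>
     \<psi> \<in> robin_test_functions D \<nu> \<beta> \<and> (\<exists>x\<in>D. \<psi> x \<noteq> 0) \<and> (\<forall>x\<in>D. - laplacian \<psi> x = chi * \<psi> x)"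

definition principal_eigenpair ::
  "'a::euclidean_space set \<Rightarrow> ('a \<Rightarrow> 'a) \<Rightarrow> real \<Rightarrow> real \<Rightarrow> ('a \<Rightarrow> real) \<Rightarrow> bool" where
  "principal_eigenpair D \<nu> \<beta> chi \<psi> \<longleftrightarrow>
     robin_eigenpair D \<nu> \<beta> chi \<psi> \<and> (\<forall>\<mu> \<phi>. robin_eigenpair D \<nu> \<beta> \<mu> \<phi> \<longrightarrow> chi \<le> \<mu>) \<and>
     0 < chi \<and> (\<forall>x\<in>D. 0 < \<psi> x) \<and> (LINT x:D|lborel. \<psi> x) = 1"

section \<open>Driving processes\<close>

text \<open>
  Filtrations are indexed by \<open>[0, \<infinity>]\<close>, so that the library notion of a stopping time applies
  to times with values in \<open>[0, \<infinity>]\<close>; processes are indexed by \<open>real\<close> and only used at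
  nonnegative times.
\<close>

definition filtered_prob_space :: "'w measure \<Rightarrow> (ennreal \<Rightarrow> 'w measure) \<Rightarrow> bool" where
  "filtered_prob_space M F \<longleftrightarrow>
     prob_space M \<and> filtration (space M) F \<and> (\<forall>t. subalgebra M (F t))"

definition adapted_process :: "(ennreal \<Rightarrow> 'w measure) \<Rightarrow> (real \<Rightarrow> 'w \<Rightarrow> real) \<Rightarrow> bool" where
  "adapted_process F X \<longleftrightarrow> (\<forall>t\<ge>0. X t \<in> borel_measurable (F (ennreal t)))"

definition brownian_motion ::
  "'w measure \<Rightarrow> (ennreal \<Rightarrow> 'w measure) \<Rightarrow> (real \<Rightarrow> 'w \<Rightarrow> real) \<Rightarrow> bool" where
  "brownian_motion M F W \<longleftrightarrow>
     adapted_process F W \<and>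
     (AE \<omega> in M. W 0 \<omega> = 0 \<and> continuous_on {0..} (\<lambda>t. W t \<omega>)) \<and>
     (\<forall>s t. 0 \<le> s \<and> s < t \<longrightarrow>
        distributed M lborel (\<lambda>\<omega>. W t \<omega> - W s \<omega>) (normal_density 0 (sqrt (t - s))) \<and>
        prob_space.indep_set M (sets (F (ennreal s)))
          (sets (vimage_algebra (space M) (\<lambda>\<omega>. W t \<omega> - W s \<omega>) borel)))"

text \<open>Real centered Gaussian variables, the degenerate one included.\<close>

definition centered_gaussian :: "'w measure \<Rightarrow> ('w \<Rightarrow> real) \<Rightarrow> bool" where
  "centered_gaussian M X \<longleftrightarrow>
     (\<exists>\<sigma>>0. distributed M lborel X (normal_density 0 \<sigma>)) \<or>
     (X \<in> borel_measurable M \<and> (AE \<omega> in M. X \<omega> = 0))"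

definition fractional_brownian_motion ::
  "'w measure \<Rightarrow> (ennreal \<Rightarrow> 'w measure) \<Rightarrow> real \<Rightarrow> (real \<Rightarrow> 'w \<Rightarrow> real) \<Rightarrow> bool" where
  "fractional_brownian_motion M F H B \<longleftrightarrow>
     adapted_process F B \<and>
     (AE \<omega> in M. continuous_on {0..} (\<lambda>t. B t \<omega>)) \<and>
     (\<forall>T c. finite T \<and> T \<subseteq> {0..} \<longrightarrow> centered_gaussian M (\<lambda>\<omega>. \<Sum>t\<in>T. c t * B t \<omega>)) \<and>
     (\<forall>s\<ge>0. \<forall>t\<ge>0. (\<integral>\<omega>. B s \<omega> * B t \<omega> \<partial>M) =
        (s powr (2 * H) + t powr (2 * H) - \<bar>t - s\<bar> powr (2 * H)) / 2)"

definition mixed_noise ::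
  "(nat \<Rightarrow> nat \<Rightarrow> real) \<Rightarrow> (real \<Rightarrow> 'w \<Rightarrow> real) \<Rightarrow> (real \<Rightarrow> 'w \<Rightarrow> real) \<Rightarrow> 'w \<Rightarrow> nat \<Rightarrow> real \<Rightarrow> real" where
  "mixed_noise k W B \<omega> i t = k i 1 * W t \<omega> + k i 2 * B t \<omega>"

section \<open>Stochastic and pathwise integrals\<close>

definition fine_partition :: "real \<Rightarrow> real \<Rightarrow> real \<Rightarrow> nat \<Rightarrow> (nat \<Rightarrow> real) \<Rightarrow> bool" where
  "fine_partition \<delta> a b n p \<longleftrightarrow>
     p 0 = a \<and> p n = b \<and> (\<forall>k<n. p k \<le> p (Suc k) \<and> p (Suc k) - p k < \<delta>)"

text \<open>
  The Young integral is the limit of Riemann--Stieltjes sums with arbitrary tags as the mesh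
  tends to 0.
\<close>

definition has_young_integral ::
  "(real \<Rightarrow> real) \<Rightarrow> (real \<Rightarrow> real) \<Rightarrow> real \<Rightarrow> real \<Rightarrow> real \<Rightarrow> bool" where
  "has_young_integral f h a b J \<longleftrightarrow>
     (\<forall>\<epsilon>>0. \<exists>\<delta>>0. \<forall>n p \<xi>. fine_partition \<delta> a b n p \<and> (\<forall>k<n. \<xi> k \<in> {p k..p (Suc k)}) \<longrightarrow>
        \<bar>(\<Sum>k<n. f (\<xi> k) * (h (p (Suc k)) - h (p k))) - J\<bar> < \<epsilon>)"

text \<open>
  \<open>I\<close> is the Ito integral process of \<open>X\<close> on the random interval \<open>[0, \<tau>)\<close>. The integrands
  considered are continuous and adapted on \<open>[0, \<tau>)\<close>; for these the Ito integral is the limit in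
  probability of the left-point Riemann sums as the mesh tends to 0.
\<close>

definition is_ito_integral ::
  "'w measure \<Rightarrow> (ennreal \<Rightarrow> 'w measure) \<Rightarrow> (real \<Rightarrow> 'w \<Rightarrow> real) \<Rightarrow> ('w \<Rightarrow> ennreal) \<Rightarrow>
   (real \<Rightarrow> 'w \<Rightarrow> real) \<Rightarrow> (real \<Rightarrow> 'w \<Rightarrow> real) \<Rightarrow> bool" where
  "is_ito_integral M F W \<tau> X I \<longleftrightarrow>
     adapted_process F (\<lambda>t \<omega>. if ennreal t < \<tau> \<omega> then X t \<omega> else 0) \<and>
     adapted_process F (\<lambda>t \<omega>. if ennreal t < \<tau> \<omega> then I t \<omega> else 0) \<and>
     (AE \<omega> in M. continuous_on {t. 0 \<le> t \<and> ennreal t < \<tau> \<omega>} (\<lambda>t. X t \<omega>) \<and>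
                 continuous_on {t. 0 \<le> t \<and> ennreal t < \<tau> \<omega>} (\<lambda>t. I t \<omega>)) \<and>
     (\<forall>t\<ge>0. \<forall>\<epsilon>>0. \<exists>\<delta>>0. \<forall>n p. fine_partition \<delta> 0 t n p \<longrightarrow>
        measure M {\<omega> \<in> space M. ennreal t < \<tau> \<omega> \<and>
          \<bar>(\<Sum>k<n. X (p k) \<omega> * (W (p (Suc k)) \<omega> - W (p k) \<omega>)) - I t \<omega>\<bar> > \<epsilon>} < \<epsilon>)"

section \<open>The systems\<close>

text \<open>
  Random fields are written \<open>u \<omega> i t x\<close>, with component index \<open>i \<in> {1, 2}\<close>; the other index is
  \<open>3 - i\<close>. A solution lives on a random interval \<open>[0, T)\<close> with \<open>0 < T \<le> \<infinity>\<close>. At time 0 it is only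
  considered on the open set \<open>D\<close>, where the initial data are given.
\<close>

definition space_time :: "'a::euclidean_space set \<Rightarrow> ennreal \<Rightarrow> (real \<times> 'a) set" where
  "space_time D T =
     {(t, x). 0 \<le> t \<and> ennreal t < T \<and> (x \<in> D \<or> 0 < t \<and> x \<in> closure D)}"

text \<open>
  The requirements under which the terms of the weak formulation make sense: the components do
  not vanish before time \<open>T\<close>, and they and their inverse squares are integrable.
\<close>

definition local_path ::
  "'a::euclidean_space set \<Rightarrow> (nat \<Rightarrow> 'a \<Rightarrow> real) \<Rightarrow> ennreal \<Rightarrow> (nat \<Rightarrow> real \<Rightarrow> 'a \<Rightarrow> real) \<Rightarrow> bool" where
  "local_path D g T u \<longleftrightarrow>
     0 < T \<and>
     (\<forall>i\<in>{1,2}.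
        (\<forall>x\<in>D. u i 0 x = g i x) \<and>
        continuous_on (space_time D T) (\<lambda>(t, x). u i t x) \<and>
        (\<forall>(t, x)\<in>space_time D T. u i t x \<noteq> 0) \<and>
        (\<forall>t. 0 \<le> t \<and> ennreal t < T \<longrightarrow>
           set_integrable lborel ({0..t} \<times> D) (\<lambda>(s, x). u i s x) \<and>
           set_integrable lborel ({0..t} \<times> D) (\<lambda>(s, x). 1 / (u i s x)\<^sup>2)))"

text \<open>
  Local weak solutions on \<open>[0, \<tau>)\<close>, with Robin boundary condition and initial value \<open>g\<^sub>i\<close>, of
  \<open>\<partial>\<^sub>t v\<^sub>i = (\<Delta> - k\<^sub>i\<^sub>1\<^sup>2/2) v\<^sub>i - lam\<^sub>i\<^sub>1 exp(3 N\<^sub>i) / v\<^sub>i\<^sup>2 - lam\<^sub>i\<^sub>2 exp(N\<^sub>i + 2 N\<^sub>j) / v\<^sub>j\<^sup>2\<close>,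
  where \<open>j = 3 - i\<close> and \<open>N\<^sub>i = k\<^sub>i\<^sub>1 W + k\<^sub>i\<^sub>2 B\<close>.
\<close>

definition weak_solution_V ::
  "'w measure \<Rightarrow> (real \<Rightarrow> 'w \<Rightarrow> real) \<Rightarrow> (real \<Rightarrow> 'w \<Rightarrow> real) \<Rightarrow>
   'a::euclidean_space set \<Rightarrow> ('a \<Rightarrow> 'a) \<Rightarrow> real \<Rightarrow> (nat \<Rightarrow> nat \<Rightarrow> real) \<Rightarrow> (nat \<Rightarrow> nat \<Rightarrow> real) \<Rightarrow>
   (nat \<Rightarrow> 'a \<Rightarrow> real) \<Rightarrow> ('w \<Rightarrow> ennreal) \<Rightarrow> ('w \<Rightarrow> nat \<Rightarrow> real \<Rightarrow> 'a \<Rightarrow> real) \<Rightarrow> bool" where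
  "weak_solution_V M W B D \<nu> \<beta> lam k g \<tau> v \<longleftrightarrow>
     (AE \<omega> in M. local_path D g (\<tau> \<omega>) (v \<omega>)) \<and>
     (\<forall>i\<in>{1,2}. \<forall>\<phi>\<in>robin_test_functions D \<nu> \<beta>.
        AE \<omega> in M. \<forall>t. 0 \<le> t \<and> ennreal t < \<tau> \<omega> \<longrightarrow>
          (LINT x:D|lborel. v \<omega> i t x * \<phi> x) =
            (LINT x:D|lborel. g i x * \<phi> x)
            + (LINT s:{0..t}|lborel. LINT x:D|lborel. v \<omega> i s x * (laplacian \<phi> x - (k i 1)\<^sup>2 / 2 * \<phi> x))
            - lam i 1 * (LINT s:{0..t}|lborel. exp (3 * mixed_noise k W B \<omega> i s) *
                (LINT x:D|lborel. 1 / (v \<omega> i s x)\<^sup>2 * \<phi> x))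
            - lam i 2 * (LINT s:{0..t}|lborel.
                exp (mixed_noise k W B \<omega> i s + 2 * mixed_noise k W B \<omega> (3 - i) s) *
                (LINT x:D|lborel. 1 / (v \<omega> (3 - i) s x)\<^sup>2 * \<phi> x)))"

text \<open>
  Local weak solutions on \<open>[0, \<tau>)\<close>, with the same boundary condition and initial values, of
  \<open>dz\<^sub>i = (\<Delta> z\<^sub>i - lam\<^sub>i\<^sub>1 / z\<^sub>i\<^sup>2 - lam\<^sub>i\<^sub>2 / z\<^sub>j\<^sup>2) dt - z\<^sub>i dN\<^sub>i\<close>. The noise integral
  \<open>\<integral>\<langle>z\<^sub>i(s), \<phi>\<rangle> dN\<^sub>i(s)\<close> is \<open>k i 1\<close> times an Ito integral plus \<open>k i 2\<close> times a Young integral.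
\<close>

definition weak_solution_Z ::
  "'w measure \<Rightarrow> (ennreal \<Rightarrow> 'w measure) \<Rightarrow> (real \<Rightarrow> 'w \<Rightarrow> real) \<Rightarrow> (real \<Rightarrow> 'w \<Rightarrow> real) \<Rightarrow>
   'a::euclidean_space set \<Rightarrow> ('a \<Rightarrow> 'a) \<Rightarrow> real \<Rightarrow> (nat \<Rightarrow> nat \<Rightarrow> real) \<Rightarrow> (nat \<Rightarrow> nat \<Rightarrow> real) \<Rightarrow>
   (nat \<Rightarrow> 'a \<Rightarrow> real) \<Rightarrow> ('w \<Rightarrow> ennreal) \<Rightarrow> ('w \<Rightarrow> nat \<Rightarrow> real \<Rightarrow> 'a \<Rightarrow> real) \<Rightarrow> bool" where
  "weak_solution_Z M F W B D \<nu> \<beta> lam k g \<tau> z \<longleftrightarrow>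
     (AE \<omega> in M. local_path D g (\<tau> \<omega>) (z \<omega>)) \<and>
     (\<forall>i\<in>{1,2}. \<forall>x\<in>D. adapted_process F (\<lambda>t \<omega>. if ennreal t < \<tau> \<omega> then z \<omega> i t x else 0)) \<and>
     (\<forall>i\<in>{1,2}. \<forall>\<phi>\<in>robin_test_functions D \<nu> \<beta>.
        \<exists>I. is_ito_integral M F W \<tau> (\<lambda>s \<omega>. LINT x:D|lborel. z \<omega> i s x * \<phi> x) I \<and>
        (AE \<omega> in M. \<forall>t. 0 \<le> t \<and> ennreal t < \<tau> \<omega> \<longrightarrow>
          (\<exists>J. has_young_integral (\<lambda>s. LINT x:D|lborel. z \<omega> i s x * \<phi> x) (\<lambda>s. B s \<omega>) 0 t J \<and>
             (LINT x:D|lborel. z \<omega> i t x * \<phi> x) =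
               (LINT x:D|lborel. g i x * \<phi> x)
               + (LINT s:{0..t}|lborel. LINT x:D|lborel. z \<omega> i s x * laplacian \<phi> x)
               - lam i 1 * (LINT s:{0..t}|lborel. LINT x:D|lborel. 1 / (z \<omega> i s x)\<^sup>2 * \<phi> x)
               - lam i 2 * (LINT s:{0..t}|lborel. LINT x:D|lborel. 1 / (z \<omega> (3 - i) s x)\<^sup>2 * \<phi> x)
               - (k i 1 * I t \<omega> + k i 2 * J))))"

section \<open>Quenching\<close>

definition quenches_at ::
  "'a::euclidean_space set \<Rightarrow> (nat \<Rightarrow> real \<Rightarrow> 'a \<Rightarrow> real) \<Rightarrow> ennreal \<Rightarrow> bool" where
  "quenches_at D u T \<longleftrightarrow>
     T < \<infinity> \<and>
     ((\<lambda>t. min (INF x\<in>closure D. \<bar>u 1 t x\<bar>) (INF x\<in>closure D. \<bar>u 2 t x\<bar>)) \<longlongrightarrow> 0)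
       (at_left (enn2real T))"

definition is_quenching_time ::
  "'w measure \<Rightarrow> (ennreal \<Rightarrow> 'w measure) \<Rightarrow> 'a::euclidean_space set \<Rightarrow>
   ('w \<Rightarrow> nat \<Rightarrow> real \<Rightarrow> 'a \<Rightarrow> real) \<Rightarrow> ('w \<Rightarrow> ennreal) \<Rightarrow> bool" where
  "is_quenching_time M F D u \<tau> \<longleftrightarrow>
     stopping_time F \<tau> \<and> (AE \<omega> in M. \<tau> \<omega> < \<infinity> \<longrightarrow> quenches_at D (u \<omega>) (\<tau> \<omega>))"

end

theory Submission
  imports Defs
begin

text \<open>
  The coefficient conditions force \<open>N\<^sub>1 = N\<^sub>2 = N\<close>. Testing the two weak equations with \<open>\<psi>\<close> and
  applying Jensen's inequality to \<open>y \<mapsto> 1 / y\<^sup>2\<close>, the energy \<open>E = \<integral> (v\<^sub>1 + v\<^sub>2) \<psi>\<close> satisfies, in integrated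
  form, \<open>E' \<le> - (chi + ksq) E - 8 ltilde exp (3 N) / E\<^sup>2\<close>. Hence
  \<open>exp (3 (chi + ksq) t) E\<^sup>3 + 24 ltilde \<integral> exp (3 N + 3 (chi + ksq) s) ds\<close> is nonincreasing. Since
  \<open>E > 0\<close> before the quenching time, the integral stays below \<open>E0\<^sup>3 / (24 ltilde)\<close> there, so the
  threshold defining \<open>\<tau>star\<close> cannot be reached before \<open>\<tau>q\<close>.
\<close>

section \<open>Comparison for integrated decay inequalities\<close>

text \<open>For a fixed slope \<open>\<epsilon> > 0\<close>, the points where \<open>\<Phi>\<close>
  lies below the line of that slope starting at \<open>(a, \<Phi> a)\<close> form a closed set. Its
  supremum must be \<open>b\<close>, since the hypothesis would otherwise supply a later point of
  the set. Letting the slope tend to 0 gives the claim.\<close>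

lemma right_Dini_nonpos_imp_le:
  fixes \<Phi> :: "real \<Rightarrow> real"
  assumes ab: "a \<le> b" and cont: "continuous_on {a..b} \<Phi>"
    and dini: "\<And>x \<epsilon>. a \<le> x \<Longrightarrow> x < b \<Longrightarrow> \<epsilon> > 0 \<Longrightarrow> \<exists>y\<in>{x<..b}. \<Phi> y \<le> \<Phi> x + \<epsilon> * (y - x)"
  shows "\<Phi> b \<le> \<Phi> a"
proof (rule field_le_epsilon)
  fix e :: real assume "e > 0"
  \<comment> \<open>The added 1 keeps the denominator positive when \<open>a = b\<close>, and
    \<open>\<epsilon> * (b - a)\<close> is still at most \<open>e\<close>.\<close>
  define \<epsilon> where "\<epsilon> = e / (b - a + 1)"
  have "\<epsilon> > 0" using ab \<open>e > 0\<close> by (simp add: \<epsilon>_def)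
  define S where "S = {x\<in>{a..b}. \<Phi> x \<le> \<Phi> a + \<epsilon> * (x - a)}"
  have "closed S" unfolding S_def
    by (intro continuous_closed_preimage_constant continuous_on_closed_Collect_le cont continuous_intros closed_atLeastAtMost)
  moreover have "a \<in> S" using ab by (simp add: S_def)
  moreover have bdd: "bdd_above S" by (rule bdd_above_mono[of "{a..b}"]) (auto simp: S_def)
  ultimately have sup: "Sup S \<in> S" by (intro closed_contains_Sup) auto
  have "Sup S = b"
  proof (rule ccontr)
    assume "Sup S \<noteq> b"
    with sup have "a \<le> Sup S" "Sup S < b" by (auto simp: S_def)
    from dini[OF this \<open>\<epsilon> > 0\<close>] obtain y where y: "Sup S < y" "y \<le> b" "\<Phi> y \<le> \<Phi> (Sup S) + \<epsilon> * (y - Sup S)"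
      by auto
    have "y \<in> S" using y sup by (auto simp: S_def algebra_simps)
    then show False using cSup_upper[OF _ bdd] y by fastforce
  qed
  with sup have "\<Phi> b \<le> \<Phi> a + \<epsilon> * (b - a)" by (simp add: S_def)
  also have "\<epsilon> * (b - a) \<le> e" using ab \<open>e > 0\<close> by (simp add: \<epsilon>_def field_simps)
  finally show "\<Phi> b \<le> \<Phi> a + e" by simp
qed

text \<open>The exponential weight absorbs the linear decay, and cubing turns the rate
  \<open>a * \<kappa> / E^2\<close> into one free of \<open>E\<close>. Since \<open>E\<close> is
  merely continuous with an integrated decay bound, the left-hand side is shown to be nonincreasing
  in time through one-sided comparison.\<close>

lemma cubic_decay_bound:
  fixes E \<kappa> :: "real \<Rightarrow> real"
  assumes b: "0 \<le> b" and contE: "continuous_on {0..b} E" and contk: "continuous_on {0..b} \<kappa>"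
    and pos: "\<And>t. t \<in> {0..b} \<Longrightarrow> E t > 0"
    and decay: "\<And>u t. 0 \<le> u \<Longrightarrow> u \<le> t \<Longrightarrow> t \<le> b \<Longrightarrow>
       E t - E u \<le> - integral {u..t} (\<lambda>s. c * E s + a * \<kappa> s / (E s)\<^sup>2)"
  shows "exp (3 * c * b) * E b ^ 3 + 3 * a * integral {0..b} (\<lambda>s. exp (3 * c * s) * \<kappa> s) \<le> E 0 ^ 3"
proof -
  define p where "p = (\<lambda>s. c * E s + a * \<kappa> s / (E s)\<^sup>2)"
  define K where "K = (\<lambda>t. integral {0..t} (\<lambda>s. exp (3 * c * s) * \<kappa> s))"
  define \<Phi> where "\<Phi> = (\<lambda>t. exp (3 * c * t) * E t ^ 3 + 3 * a * K t)"
  have contp: "continuous_on {0..b} p" unfolding p_def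
    using pos by (intro continuous_intros contE contk) fastforce
  have contx: "continuous_on {0..b} (\<lambda>s. exp (3 * c * s) * \<kappa> s)"
    by (intro continuous_intros contk)
  have derK: "(K has_real_derivative exp (3 * c * x) * \<kappa> x) (at x within {0..b})" if "x \<in> {0..b}" for x
    unfolding K_def using integral_has_real_derivative[OF contx that] .
  have contK: "continuous_on {0..b} K"
    by (rule DERIV_continuous_on[OF derK])
  have "\<Phi> b \<le> \<Phi> 0"
  proof (rule right_Dini_nonpos_imp_le[OF b])
    show "continuous_on {0..b} \<Phi>" unfolding \<Phi>_def by (intro continuous_intros contE contK)
    fix x \<epsilon> :: real assume x: "0 \<le> x" "x < b" and "\<epsilon> > 0"
    \<comment> \<open>\<open>h\<close> agrees with \<open>E\<close> at \<open>x\<close>, has slope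
      \<open>- p x\<close> there and lies above \<open>E\<close> afterwards. So \<open>G\<close> is
      a majorant of \<open>\<Phi>\<close> to the right of \<open>x\<close> that touches it at
      \<open>x\<close> and has a right derivative there.\<close>
    define h where "h = (\<lambda>t. E x - integral {x..t} p)"
    define G where "G = (\<lambda>t. exp (3 * c * t) * h t ^ 3 + 3 * a * K t)"
    have hx: "h x = E x" by (simp add: h_def)
    have sub: "{x..b} \<subseteq> {0..b}" using x by auto
    have "((\<lambda>t. integral {x..t} p) has_real_derivative p x) (at x within {x..b})"
      using x by (intro integral_has_real_derivative continuous_on_subset[OF contp sub]) auto
    then have derh: "(h has_real_derivative - p x) (at x within {x..b})"
      unfolding h_def by (auto intro!: derivative_eq_intros)
    have derK': "(K has_real_derivative exp (3 * c * x) * \<kappa> x) (at x within {x..b})"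
      using derK[of x] x by (intro DERIV_subset[OF _ sub]) auto
    have Ex: "E x > 0" using pos x by auto
    have "(G has_real_derivative
        exp (3 * c * x) * (3 * c) * h x ^ 3 + exp (3 * c * x) * (3 * h x ^ 2 * (- p x))
          + 3 * a * (exp (3 * c * x) * \<kappa> x)) (at x within {x..b})"
      unfolding G_def
      by (rule derivative_eq_intros derh derK' refl)+ (simp add: algebra_simps)
    \<comment> \<open>With \<open>h x = E x\<close>, the terms in \<open>c\<close> cancel, and the
      factor \<open>(h x)^2\<close> cancels the denominator in \<open>p x\<close>, leaving opposite
      terms in \<open>\<kappa> x\<close>.\<close>
    also have "exp (3 * c * x) * (3 * c) * h x ^ 3 + exp (3 * c * x) * (3 * h x ^ 2 * (- p x))
          + 3 * a * (exp (3 * c * x) * \<kappa> x) = 0"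
      using Ex unfolding hx p_def by (simp add: field_simps power2_eq_square power3_eq_cube)
    finally have "((\<lambda>y. (G y - G x) / (y - x)) \<longlongrightarrow> 0) (at x within {x..b})"
      by (simp add: has_field_derivative_iff)
    then have ev: "\<forall>\<^sub>F y in at x within {x..b}. (G y - G x) / (y - x) < \<epsilon>"
      using \<open>\<epsilon> > 0\<close> by (simp add: order_tendsto_iff)
    have "at x within {x..b} = at_right x" using x by (simp add: at_within_Icc_at_right)
    then obtain y where y: "x < y" "y \<le> b" "(G y - G x) / (y - x) < \<epsilon>"
      using ev eventually_at_right_field[of _ x] x
      by (metis (no_types, lifting) dense min_less_iff_conj not_less order_less_imp_le)
    have "E y \<le> h y" using decay[of x y] x y unfolding h_def p_def by simp
    moreover have "E y > 0" using pos x y by auto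
    ultimately have "\<Phi> y \<le> G y" unfolding \<Phi>_def G_def
      by (intro add_right_mono mult_left_mono power_mono) auto
    also have "G y \<le> G x + \<epsilon> * (y - x)" using y by (simp add: field_simps)
    also have "G x = \<Phi> x" by (simp add: G_def \<Phi>_def hx)
    finally show "\<exists>y\<in>{x<..b}. \<Phi> y \<le> \<Phi> x + \<epsilon> * (y - x)" using y by auto
  qed
  then show ?thesis by (simp add: \<Phi>_def K_def)
qed

section \<open>Continuity, integrability and strict positivity of integrals\<close>

lemma C_on_Suc_imp_continuous_on: "C_on (Suc n) f S \<Longrightarrow> continuous_on S f"
  by (auto intro!: continuous_at_imp_continuous_on differentiable_imp_continuous_within)

text \<open>A vanishing integral would force \<open>w = 0\<close> almost everywhere on
  \<open>D\<close>, so \<open>D\<close> would be a null set, which a nonempty open set is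
  not.\<close>

lemma set_integral_pos_open:
  fixes w \<psi> :: "'a::euclidean_space \<Rightarrow> real"
  assumes D: "open D" "D \<noteq> {}"
    and pos: "\<And>x. x \<in> D \<Longrightarrow> w x > 0"
    and int: "set_integrable lborel D w"
  shows "(LINT x:D|lborel. w x) > 0"
proof -
  have nn: "(LINT x:D|lborel. w x) \<ge> 0"
    unfolding set_lebesgue_integral_def using pos
    by (intro integral_nonneg_AE) (auto simp: indicator_def less_imp_le)
  moreover have "(LINT x:D|lborel. w x) \<noteq> 0"
  proof
    assume "(LINT x:D|lborel. w x) = 0"
    then have "AE x in lborel. indicator D x *\<^sub>R w x = 0"
      using int pos unfolding set_lebesgue_integral_def set_integrable_def
      by (subst (asm) integral_nonneg_eq_0_iff_AE) (auto simp: indicator_def less_imp_le)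
    then have "AE x in lborel. x \<notin> D"
      by eventually_elim (use pos in \<open>force simp: indicator_def split: if_splits\<close>)
    then have "emeasure lborel D = 0"
      using D by (subst (asm) AE_iff_measurable[of D]) auto
    then have "D \<in> null_sets lebesgue"
      using D by (intro null_sets_completionI) (auto simp: null_sets_def)
    then show False using open_not_negligible[OF D] by (simp add: negligible_iff_null_sets)
  qed
  ultimately show ?thesis by simp
qed

lemma set_integrable_continuous_on_closure:
  fixes w :: "'a::euclidean_space \<Rightarrow> real"
  assumes "open D" "bounded D" "continuous_on (closure D) w"
  shows "set_integrable lborel D w"
proof -
  have "set_integrable lborel (closure D) w"
    using assms unfolding set_integrable_def
    by (intro borel_integrable_compact) (auto simp: compact_eq_bounded_closed)
  then show ?thesis
    by (rule set_integrable_subset) (use assms(1) in \<open>auto simp: closure_subset\<close>)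
qed

text \<open>The cut-off by \<open>A\<close> in the measurability assumption admits factors such as
  \<open>g i\<close> and \<open>\<psi>\<close>, which are controlled only on the domain.\<close>

lemma set_integrable_mult_bounded:
  fixes f h :: "'b \<Rightarrow> real"
  assumes f: "set_integrable M A f" and h: "(\<lambda>x. indicator A x * h x) \<in> borel_measurable M"
    and bound: "\<And>x. x \<in> A \<Longrightarrow> \<bar>h x\<bar> \<le> C"
  shows "set_integrable M A (\<lambda>x. f x * h x)"
proof -
  have f': "integrable M (\<lambda>x. indicator A x * f x)"
    using f by (simp add: set_integrable_def)
  have "(\<lambda>x. (indicator A x * f x) * (indicator A x * h x)) \<in> borel_measurable M"
    using borel_measurable_integrable[OF f'] h by measurable
  moreover have "(\<lambda>x. (indicator A x * f x) * (indicator A x * h x)) = (\<lambda>x. indicator A x *\<^sub>R (f x * h x))"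
    by (auto simp: indicator_def)
  ultimately have meas: "(\<lambda>x. indicator A x *\<^sub>R (f x * h x)) \<in> borel_measurable M" by simp
  show ?thesis unfolding set_integrable_def
  proof (rule Bochner_Integration.integrable_bound[OF integrable_mult_right[OF f', of C] meas])
    show "AE x in M. norm (indicator A x *\<^sub>R (f x * h x)) \<le> norm (C * (indicator A x * f x))"
    proof (rule AE_I2)
      fix x
      show "norm (indicator A x *\<^sub>R (f x * h x)) \<le> norm (C * (indicator A x * f x))"
      proof (cases "x \<in> A")
        case True
        then have "\<bar>f x\<bar> * \<bar>h x\<bar> \<le> \<bar>f x\<bar> * \<bar>C\<bar>"
          using bound[of x] by (intro mult_left_mono) auto
        then show ?thesis using True by (simp add: abs_mult mult.commute)
      qed simp
    qed
  qed
qed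

text \<open>Fubini's theorem on \<open>A \<times> D\<close>. It converts the space-time
  integrability in \<open>local_path\<close> into time integrability of spatial averages.\<close>

lemma set_integrable_slice_integral:
  fixes u :: "real \<Rightarrow> 'a::euclidean_space \<Rightarrow> real"
  assumes "set_integrable lborel (A \<times> D) (\<lambda>(s, x). u s x)"
  shows "set_integrable lborel A (\<lambda>s. LINT x:D|lborel. u s x)"
proof -
  have "integrable (lborel \<Otimes>\<^sub>M lborel) (\<lambda>p. indicator (A \<times> D) p *\<^sub>R (case p of (s, x) \<Rightarrow> u s x))"
    using assms by (simp add: set_integrable_def lborel_prod)
  from lborel_pair.integrable_fst'[OF this]
  have "integrable lborel (\<lambda>s. \<integral>x. indicator (A \<times> D) (s, x) *\<^sub>R u s x \<partial>lborel)"
    by simp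
  also have "(\<lambda>s. \<integral>x. indicator (A \<times> D) (s, x) *\<^sub>R u s x \<partial>lborel) =
      (\<lambda>s. indicator A s *\<^sub>R (LINT x:D|lborel. u s x))"
    unfolding set_lebesgue_integral_def by (auto simp: indicator_times mult.assoc)
  finally show ?thesis by (simp add: set_integrable_def)
qed

section \<open>Spatial slices, positivity and convexity along a path\<close>

text \<open>\<open>space_time\<close> contains the whole closed slice only at positive times; at
  time 0 it contains just \<open>D\<close>, hence the condition \<open>0 < t\<close>.\<close>

lemma local_path_continuous_slice:
  assumes path: "local_path D g T u" and i: "i \<in> {1,2}" and t: "0 < t" "ennreal t < T"
  shows "continuous_on (closure D) (u i t)" "\<And>x. x \<in> closure D \<Longrightarrow> u i t x \<noteq> 0"
proof -
  have "continuous_on (space_time D T) (\<lambda>(t, x). u i t x)"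
    using path i unfolding local_path_def by blast
  moreover have sub: "(\<lambda>x. (t, x)) ` closure D \<subseteq> space_time D T"
    using t by (auto simp: space_time_def)
  ultimately have "continuous_on (closure D) ((\<lambda>(t, x). u i t x) \<circ> (\<lambda>x. (t, x)))"
    by (intro continuous_on_compose continuous_intros) (auto intro: continuous_on_subset)
  then show "continuous_on (closure D) (u i t)" by (simp add: o_def)
  show "u i t x \<noteq> 0" if "x \<in> closure D" for x
    using path i that sub unfolding local_path_def by fastforce
qed

text \<open>A continuous function without zeros on the connected set
  \<open>{0..t} \<times> D\<close> cannot change sign, and it is positive at time 0.\<close>

lemma local_path_pos:
  assumes path: "local_path D g T u" and i: "i \<in> {1,2}" and "connected D"
    and g: "\<And>x. x \<in> D \<Longrightarrow> g i x > 0"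
    and t: "0 \<le> t" "ennreal t < T" and x: "x \<in> D"
  shows "u i t x > 0"
proof -
  define w where "w = (\<lambda>(t, x). u i t x)"
  have cont: "continuous_on (space_time D T) w" and nz: "\<forall>p\<in>space_time D T. w p \<noteq> 0"
    using path i unfolding local_path_def w_def by (blast, fastforce)
  have sub: "{0..t} \<times> D \<subseteq> space_time D T"
    using t by (auto simp: space_time_def intro: le_less_trans[OF ennreal_leI])
  have "connected (w ` ({0..t} \<times> D))"
    using \<open>connected D\<close> by (intro connected_continuous_image continuous_on_subset[OF cont sub] connected_Times) auto
  moreover have "w (0, x) \<in> w ` ({0..t} \<times> D)" "w (t, x) \<in> w ` ({0..t} \<times> D)"
    using t x by auto
  moreover have "0 \<notin> w ` ({0..t} \<times> D)" using nz sub by force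
  moreover have "w (0, x) > 0"
    using path i g[OF x] x unfolding local_path_def w_def by auto
  ultimately have "w (t, x) > 0"
    by (meson connected_iff_interval less_imp_le not_less)
  then show ?thesis by (simp add: w_def)
qed

text \<open>Jensen's inequality for \<open>y \<mapsto> 1 / y\<^sup>2\<close>, in the form of its tangent line at \<open>m\<close>.\<close>

lemma set_integral_inverse_square_tangent:
  fixes w \<psi> :: "'b \<Rightarrow> real"
  assumes w: "\<And>x. x \<in> D \<Longrightarrow> w x > 0" and psi: "\<And>x. x \<in> D \<Longrightarrow> \<psi> x > 0"
    and int: "set_integrable M D \<psi>" "(LINT x:D|M. \<psi> x) = 1"
      "set_integrable M D (\<lambda>x. w x * \<psi> x)" "set_integrable M D (\<lambda>x. 1 / (w x)\<^sup>2 * \<psi> x)"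
    and m: "m > 0"
  shows "3 / m\<^sup>2 - 2 / m ^ 3 * (LINT x:D|M. w x * \<psi> x) \<le> (LINT x:D|M. 1 / (w x)\<^sup>2 * \<psi> x)"
proof -
  have tangent: "3 / m\<^sup>2 - 2 / m ^ 3 * y \<le> 1 / y\<^sup>2" if "y > 0" for y :: real
  proof -
    have "3 * m * y\<^sup>2 - 2 * y ^ 3 \<le> m ^ 3"
    proof -
      \<comment> \<open>The tangent inequality with denominators cleared: tangency at
        \<open>y = m\<close> gives the double root, and the remaining factor is positive.\<close>
      have "m ^ 3 - (3 * m * y\<^sup>2 - 2 * y ^ 3) = (m - y)\<^sup>2 * (m + 2 * y)"
        by (simp add: power2_eq_square power3_eq_cube algebra_simps)
      also have "\<dots> \<ge> 0" using m that by simp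
      finally show ?thesis by simp
    qed
    then show ?thesis using m that
      by (simp add: field_simps power2_eq_square power3_eq_cube)
  qed
  have "(LINT x:D|M. 3 / m\<^sup>2 * \<psi> x - 2 / m ^ 3 * (w x * \<psi> x)) \<le> (LINT x:D|M. 1 / (w x)\<^sup>2 * \<psi> x)"
  proof (rule set_integral_mono)
    fix x assume "x \<in> D"
    from mult_right_mono[OF tangent[OF w[OF this]] less_imp_le[OF psi[OF this]]]
    show "3 / m\<^sup>2 * \<psi> x - 2 / m ^ 3 * (w x * \<psi> x) \<le> 1 / (w x)\<^sup>2 * \<psi> x"
      by (simp add: algebra_simps)
  qed (use int in \<open>auto\<close>)
  also have "(LINT x:D|M. 3 / m\<^sup>2 * \<psi> x - 2 / m ^ 3 * (w x * \<psi> x)) =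
      3 / m\<^sup>2 - 2 / m ^ 3 * (LINT x:D|M. w x * \<psi> x)"
    using int by (subst set_integral_diff) auto
  finally show ?thesis .
qed

section \<open>The energy estimate along one path\<close>

text \<open>This is the deterministic core, applied to single sample paths with
  \<open>c = chi + ksq\<close>. The constant 24 is 3 times 8: the 3 comes from differentiating a
  cube, the 8 from Jensen's inequality for the sum of two components.\<close>

lemma energy_bound:
  fixes v :: "nat \<Rightarrow> real \<Rightarrow> 'a::euclidean_space \<Rightarrow> real" and N :: "real \<Rightarrow> real"
    and g :: "nat \<Rightarrow> 'a \<Rightarrow> real" and l :: "nat \<Rightarrow> nat \<Rightarrow> real"
  assumes D: "open D" "connected D" "D \<noteq> {}" "bounded D"
    and psi: "continuous_on (closure D) \<psi>" "\<And>x. x \<in> D \<Longrightarrow> \<psi> x > 0" "(LINT x:D|lborel. \<psi> x) = 1"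
    and g: "\<And>i. i \<in> {1,2} \<Longrightarrow> continuous_on D (g i)"
      "\<And>i x. i \<in> {1,2} \<Longrightarrow> x \<in> D \<Longrightarrow> 0 < g i x \<and> g i x \<le> 1"
    and l: "\<And>i m. i \<in> {1,2} \<Longrightarrow> m \<in> {1,2} \<Longrightarrow> l i m > 0"
    and path: "local_path D g T v" and N: "continuous_on {0..} N"
    and weak: "\<And>i t. i \<in> {1,2} \<Longrightarrow> 0 \<le> t \<Longrightarrow> ennreal t < T \<Longrightarrow>
      (LINT x:D|lborel. v i t x * \<psi> x) = (LINT x:D|lborel. g i x * \<psi> x)
       - (LINT s:{0..t}|lborel. c * (LINT x:D|lborel. v i s x * \<psi> x))
       - l i 1 * (LINT s:{0..t}|lborel. exp (3 * N s) * (LINT x:D|lborel. 1 / (v i s x)\<^sup>2 * \<psi> x))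
       - l i 2 * (LINT s:{0..t}|lborel. exp (3 * N s) * (LINT x:D|lborel. 1 / (v (3 - i) s x)\<^sup>2 * \<psi> x))"
    and b: "0 \<le> b" "ennreal b < T"
  shows "24 * min (l 1 1 + l 2 2) (l 1 2 + l 2 1) *
      (LINT s:{0..b}|lborel. exp (3 * N s) * exp (3 * c * s)) < (LINT x:D|lborel. (g 1 x + g 2 x) * \<psi> x) ^ 3"
proof -
  define L where "L = min (l 1 1 + l 2 2) (l 1 2 + l 2 1)"
  define e where "e = (\<lambda>i t. LINT x:D|lborel. v i t x * \<psi> x)"
  define J where "J = (\<lambda>i t. LINT x:D|lborel. 1 / (v i t x)\<^sup>2 * \<psi> x)"
  define E where "E = (\<lambda>t. e 1 t + e 2 t)"
  \<comment> \<open>The decay rate of \<open>E\<close>. The term \<open>J 1\<close> enters the first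
    equation with weight \<open>l 1 1\<close> and the second with weight \<open>l 2 2\<close>;
    likewise \<open>J 2\<close> collects \<open>l 1 2\<close> and \<open>l 2 1\<close>. This is the
    origin of the two sums in \<open>L\<close>.\<close>
  define h where "h = (\<lambda>s. c * E s + exp (3 * N s) * ((l 1 1 + l 2 2) * J 1 s + (l 1 2 + l 2 1) * J 2 s))"
  have below: "ennreal t < T" if "t \<in> {0..b}" for t
    using that b by (auto intro: le_less_trans[OF ennreal_leI])
  have L: "L > 0" using l by (simp add: L_def add_pos_pos)

  have "compact (closure D)" using D by (simp add: compact_closure)
  then obtain C where C: "\<And>x. x \<in> closure D \<Longrightarrow> \<bar>\<psi> x\<bar> \<le> C"
    using compact_imp_bounded[OF compact_continuous_image[OF psi(1)]]
    by (auto simp: bounded_iff)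
  have psiD: "continuous_on D \<psi>" using psi(1) closure_subset continuous_on_subset by blast
  have psi_int: "set_integrable lborel D \<psi>"
    by (rule set_integrable_continuous_on_closure[OF D(1,4) psi(1)])

  have v0: "v i 0 x = g i x" if "i \<in> {1,2}" "x \<in> D" for i x
    using path that unfolding local_path_def by blast
  have vpos: "v i t x > 0" if "i \<in> {1,2}" "t \<in> {0..b}" "x \<in> D" for i t x
    using local_path_pos[OF path that(1) D(2)] g that below by auto
  \<comment> \<open>At time 0 the bound \<open>g i \<le> 1\<close> on \<open>D\<close> is used; at
    later times continuity on the compact closure gives integrability.\<close>
  have int_v: "set_integrable lborel D (\<lambda>x. v i t x * \<psi> x)" if i: "i \<in> {1,2}" and t: "t \<in> {0..b}" for i t
  proof (cases "t = 0")
    case True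
    have "set_integrable lborel D (\<lambda>x. \<psi> x * g i x)"
    proof (rule set_integrable_mult_bounded[OF psi_int])
      show "(\<lambda>x. indicator D x * g i x) \<in> borel_measurable lborel"
        using borel_measurable_continuous_on_indicator[OF _ g(1)[OF i]] D(1) by simp
      show "\<bar>g i x\<bar> \<le> 1" if "x \<in> D" for x using g(2)[OF i that] by simp
    qed
    then show ?thesis
      by (rule set_integrable_cong[THEN iffD1, rotated 3]) (auto simp: True v0[OF i])
  next
    case False
    then show ?thesis using local_path_continuous_slice[OF path i, of t] t below[OF t]
      by (intro set_integrable_continuous_on_closure D continuous_intros psi) auto
  qed
  \<comment> \<open>Time 0 is excluded because \<open>g i\<close> may approach 0 at the boundary,
    with no control on its inverse square.\<close>
  have int_J: "set_integrable lborel D (\<lambda>x. 1 / (v i t x)\<^sup>2 * \<psi> x)"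
    if i: "i \<in> {1,2}" and t: "t \<in> {0..b}" "t \<noteq> 0" for i t
    using local_path_continuous_slice[OF path i, of t] t below[OF t(1)]
    by (intro set_integrable_continuous_on_closure D continuous_intros psi) auto
  have epos: "e i t > 0" if "i \<in> {1,2}" "t \<in> {0..b}" for i t
    unfolding e_def using that vpos psi int_v D by (intro set_integral_pos_open) auto
  have Epos: "E t > 0" if "t \<in> {0..b}" for t using epos[of 1 t] epos[of 2 t] that by (simp add: E_def)
  have Jpos: "J i t \<ge> 0" if "i \<in> {1,2}" "t \<in> {0..b}" for i t
    unfolding J_def set_lebesgue_integral_def
    using psi(2) by (intro integral_nonneg_AE) (auto simp: indicator_def less_imp_le)

  have psi_meas: "(\<lambda>p. indicator ({0..t} \<times> D) p * \<psi> (snd p)) \<in> borel_measurable lborel" for t :: real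
  proof -
    have meas: "(\<lambda>x. indicator D x * \<psi> x) \<in> borel_measurable borel"
      using borel_measurable_continuous_on_indicator[OF _ psiD] D(1) by simp
    have "(\<lambda>p::real \<times> 'a. indicator {0..t} (fst p) * (indicator D (snd p) * \<psi> (snd p)))
        \<in> borel_measurable (borel \<Otimes>\<^sub>M borel)"
      by (rule borel_measurable_times[OF measurable_compose[OF measurable_fst borel_measurable_indicator]
          measurable_compose[OF measurable_snd meas]]) auto
    then have "(\<lambda>p::real \<times> 'a. indicator {0..t} (fst p) * (indicator D (snd p) * \<psi> (snd p)))
        \<in> borel_measurable borel"
      by (simp only: borel_prod)
    also have "(\<lambda>p. indicator {0..t} (fst p) * (indicator D (snd p) * \<psi> (snd p))) =
        (\<lambda>p. indicator ({0..t} \<times> D) p * \<psi> (snd p))"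
      by (auto simp: indicator_def)
    finally show ?thesis by simp
  qed
  have slice: "set_integrable lborel {0..t} (\<lambda>s. LINT x:D|lborel. u s x * \<psi> x)"
    if "set_integrable lborel ({0..t} \<times> D) (\<lambda>(s, x). u s x)" for t :: real and u
  proof -
    have "set_integrable lborel ({0..t} \<times> D) (\<lambda>p. (case p of (s, x) \<Rightarrow> u s x) * \<psi> (snd p))"
      by (rule set_integrable_mult_bounded[OF that psi_meas, where C = C]) (use C closure_subset[of D] in auto)
    then show ?thesis by (intro set_integrable_slice_integral) (simp add: case_prod_unfold)
  qed
  have int_e: "set_integrable lborel {0..t} (e i)" if "i \<in> {1,2}" "t \<in> {0..b}" for i t
  proof -
    have "set_integrable lborel ({0..t} \<times> D) (\<lambda>(s, x). v i s x)"
      using path that(1) below[OF that(2)] that(2) unfolding local_path_def atLeastAtMost_iff by blast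
    then show ?thesis unfolding e_def by (rule slice)
  qed
  have int_J': "set_integrable lborel {0..t} (J i)" if "i \<in> {1,2}" "t \<in> {0..b}" for i t
  proof -
    have "set_integrable lborel ({0..t} \<times> D) (\<lambda>(s, x). 1 / (v i s x)\<^sup>2)"
      using path that(1) below[OF that(2)] that(2) unfolding local_path_def atLeastAtMost_iff by blast
    then show ?thesis unfolding J_def by (rule slice)
  qed
  have cont_exp: "continuous_on {0..t} (\<lambda>s. exp (3 * N s))" for t
    by (intro continuous_intros continuous_on_subset[OF N]) auto
  have int_expJ: "set_integrable lborel {0..t} (\<lambda>s. exp (3 * N s) * J i s)"
    if "i \<in> {1,2}" "t \<in> {0..b}" for i t
  proof -
    have "\<exists>K. \<forall>s\<in>{0..t}. \<bar>exp (3 * N s)\<bar> \<le> K"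
      using compact_imp_bounded[OF compact_continuous_image[OF cont_exp[of t]]]
      by (simp add: bounded_iff)
    then obtain K where "\<And>s. s \<in> {0..t} \<Longrightarrow> \<bar>exp (3 * N s)\<bar> \<le> K" by blast
    then have "set_integrable lborel {0..t} (\<lambda>s. J i s * exp (3 * N s))"
      using borel_measurable_continuous_on_indicator[OF _ cont_exp[of t]]
      by (intro set_integrable_mult_bounded[OF int_J'[OF that]]) auto
    then show ?thesis by (simp add: mult.commute)
  qed

  have weak': "e i t = e i 0 - c * (LINT s:{0..t}|lborel. e i s)
       - l i 1 * (LINT s:{0..t}|lborel. exp (3 * N s) * J i s)
       - l i 2 * (LINT s:{0..t}|lborel. exp (3 * N s) * J (3 - i) s)"
    if i: "i \<in> {1,2}" and t: "t \<in> {0..b}" for i t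
  proof -
    have "(LINT x:D|lborel. g i x * \<psi> x) = e i 0"
      unfolding e_def by (rule set_lebesgue_integral_cong) (use D v0[OF i] in auto)
    then show ?thesis using weak[OF i _ below[OF t]] t
      unfolding e_def J_def by simp
  qed
  have int_h: "set_integrable lborel {0..t} h" and Eh: "E t = E 0 - (LINT s:{0..t}|lborel. h s)"
    if t: "t \<in> {0..b}" for t
  proof -
    have h_eq: "h = (\<lambda>s. (c * e 1 s + c * e 2 s) + ((l 1 1 + l 2 2) * (exp (3 * N s) * J 1 s)
        + (l 1 2 + l 2 1) * (exp (3 * N s) * J 2 s)))"
      by (auto simp: h_def E_def algebra_simps)
    have ints: "set_integrable lborel {0..t} (\<lambda>s. c * e 1 s)" "set_integrable lborel {0..t} (\<lambda>s. c * e 2 s)"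
      "set_integrable lborel {0..t} (\<lambda>s. (l 1 1 + l 2 2) * (exp (3 * N s) * J 1 s))"
      "set_integrable lborel {0..t} (\<lambda>s. (l 1 2 + l 2 1) * (exp (3 * N s) * J 2 s))"
      using int_e[OF _ t] int_expJ[OF _ t] by (auto intro!: set_integrable_mult_right)
    show "set_integrable lborel {0..t} h" unfolding h_eq
      by (intro set_integral_add ints)
    have "(LINT s:{0..t}|lborel. h s) = c * (LINT s:{0..t}|lborel. e 1 s) + c * (LINT s:{0..t}|lborel. e 2 s)
       + ((l 1 1 + l 2 2) * (LINT s:{0..t}|lborel. exp (3 * N s) * J 1 s)
        + (l 1 2 + l 2 1) * (LINT s:{0..t}|lborel. exp (3 * N s) * J 2 s))"
      unfolding h_eq using ints by (simp only: set_integral_add set_integral_mult_right)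
    then show "E t = E 0 - (LINT s:{0..t}|lborel. h s)"
      using weak'[of 1 t] weak'[of 2 t] t unfolding E_def by (simp add: algebra_simps)
  qed
  have h_on: "h integrable_on {0..b}" using set_borel_integral_eq_integral(1)[OF int_h] b by simp
  have Eh': "E t = E 0 - integral {0..t} h" if "t \<in> {0..b}" for t
    using Eh[OF that] set_borel_integral_eq_integral(2)[OF int_h[OF that]] by simp
  \<comment> \<open>Continuity of the energy, including at time 0, is read off from its
    representation as an indefinite integral.\<close>
  have "continuous_on {0..b} (\<lambda>t. E 0 - integral {0..t} h)"
    by (intro continuous_intros indefinite_integral_continuous_1 h_on)
  then have contE: "continuous_on {0..b} E"
    by (subst continuous_on_cong[OF refl Eh']) auto

  have h_ge: "c * E s + 8 * L * exp (3 * N s) / (E s)\<^sup>2 \<le> h s" if s: "s \<in> {0..b}" "s \<noteq> 0" for s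
  proof -
    \<comment> \<open>Half the energy is the mean of \<open>e 1 s\<close> and \<open>e 2 s\<close>.
      Taking it as the common tangent point, the two bounds add up to
      \<open>6 / m^2 - 4 / m^2 = 8 / (E s)^2\<close>.\<close>
    define m where "m = E s / 2"
    have m: "m > 0" using Epos[OF s(1)] by (simp add: m_def)
    have "3 / m\<^sup>2 - 2 / m ^ 3 * e i s \<le> J i s" if "i \<in> {1,2}" for i
      unfolding e_def J_def
      using that vpos psi psi_int int_v int_J s m by (intro set_integral_inverse_square_tangent) auto
    from this[of 1] this[of 2] have "6 / m\<^sup>2 - 2 / m ^ 3 * (e 1 s + e 2 s) \<le> J 1 s + J 2 s"
      by (simp add: algebra_simps)
    also have "e 1 s + e 2 s = 2 * m" by (simp add: m_def E_def)
    also have "6 / m\<^sup>2 - 2 / m ^ 3 * (2 * m) = 8 / (E s)\<^sup>2"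
      using m unfolding m_def by (simp add: field_simps power2_eq_square power3_eq_cube)
    finally have "L * (8 / (E s)\<^sup>2) \<le> L * (J 1 s + J 2 s)"
      using L by (intro mult_left_mono) auto
    also have "\<dots> \<le> (l 1 1 + l 2 2) * J 1 s + (l 1 2 + l 2 1) * J 2 s"
      unfolding distrib_left using Jpos s by (intro add_mono mult_right_mono) (auto simp: L_def)
    finally have "exp (3 * N s) * (L * (8 / (E s)\<^sup>2)) \<le>
        exp (3 * N s) * ((l 1 1 + l 2 2) * J 1 s + (l 1 2 + l 2 1) * J 2 s)"
      by (intro mult_left_mono) auto
    then show ?thesis by (simp add: h_def mult_ac)
  qed
  have "exp (3 * c * b) * E b ^ 3 + 3 * (8 * L) * integral {0..b} (\<lambda>s. exp (3 * c * s) * exp (3 * N s)) \<le> E 0 ^ 3"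
  proof (rule cubic_decay_bound[OF b(1) contE cont_exp Epos])
    fix u t :: real assume ut: "0 \<le> u" "u \<le> t" "t \<le> b"
    define p where "p = (\<lambda>s. c * E s + 8 * L * exp (3 * N s) / (E s)\<^sup>2)"
    \<comment> \<open>The lower bound \<open>h_ge\<close> is available only for
      \<open>s \<noteq> 0\<close>. Altering the integrand at this single point makes the comparison
      pointwise everywhere without changing the integral.\<close>
    define p' where "p' = (\<lambda>s. if s = 0 then h 0 else p s)"
    have sub: "{u..t} \<subseteq> {0..b}" using ut by auto
    have "continuous_on {u..t} p" unfolding p_def
      using Epos sub by (intro continuous_intros continuous_on_subset[OF contE sub] 
        continuous_on_subset[OF cont_exp sub]) fastforce
    then have "p integrable_on {u..t}" by (rule integrable_continuous_real)
    then have p': "p' integrable_on {u..t}"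
      by (rule integrable_spike[of _ _ "{0}"]) (auto simp: p'_def)
    have "integral {u..t} p = integral {u..t} p'"
      by (rule integral_spike[of "{0}"]) (auto simp: p'_def)
    also have "\<dots> \<le> integral {u..t} h"
      using h_ge sub unfolding p'_def p_def
      by (intro integral_le p'[unfolded p'_def p_def] integrable_subinterval_real[OF h_on sub]) auto
    also have "integral {0..u} h + integral {u..t} h = integral {0..t} h"
      using ut by (intro Henstock_Kurzweil_Integration.integral_combine
          integrable_subinterval_real[OF h_on]) auto
    then have "integral {u..t} h = E u - E t" using Eh'[of u] Eh'[of t] ut by simp
    finally show "E t - E u \<le> - integral {u..t} (\<lambda>s. c * E s + 8 * L * exp (3 * N s) / (E s)\<^sup>2)"
      unfolding p_def by simp
  qed
  \<comment> \<open>Dropping this strictly positive term is what makes the final inequality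
    strict.\<close>
  moreover have "exp (3 * c * b) * E b ^ 3 > 0" using Epos[of b] b by simp
  ultimately have I: "24 * L * integral {0..b} (\<lambda>s. exp (3 * c * s) * exp (3 * N s)) < E 0 ^ 3" by simp
  have "set_integrable lborel {0..b} (\<lambda>s. exp (3 * c * s) * exp (3 * N s))"
    unfolding set_integrable_def
    by (intro borel_integrable_compact continuous_intros cont_exp) auto
  then have LI: "(LINT s:{0..b}|lborel. exp (3 * N s) * exp (3 * c * s)) =
      integral {0..b} (\<lambda>s. exp (3 * c * s) * exp (3 * N s))"
    by (subst mult.commute) (rule set_borel_integral_eq_integral(2))
  have "E 0 = (LINT x:D|lborel. (g 1 x + g 2 x) * \<psi> x)"
  proof -
    have "E 0 = (LINT x:D|lborel. v 1 0 x * \<psi> x + v 2 0 x * \<psi> x)"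
      unfolding E_def e_def using int_v b by (subst set_integral_add) auto
    also have "\<dots> = (LINT x:D|lborel. (g 1 x + g 2 x) * \<psi> x)"
      using D v0 by (intro set_lebesgue_integral_cong) (auto simp: algebra_simps)
    finally show ?thesis .
  qed
  then show ?thesis using I LI by (simp add: L_def)
qed

section \<open>Transfer of quenching between the two systems\<close>

lemma INF_mult_left_real:
  fixes f :: "'b \<Rightarrow> real"
  assumes "c \<ge> 0" "A \<noteq> {}" "bdd_below (f ` A)"
  shows "(INF x\<in>A. c * f x) = c * (INF x\<in>A. f x)"
proof -
  have "c * Inf (f ` A) = (INF y\<in>f ` A. c * y)"
    using assms by (intro continuous_at_Inf_mono monoI mult_left_mono continuous_intros) auto
  then show ?thesis by (simp add: image_image)
qed

text \<open>Both components differ by the same factor \<open>exp (N t)\<close>, so the minimum over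
  both is rescaled as a whole. By continuity of \<open>N\<close>, the inverse factor has a finite
  limit at the finite time \<open>T\<close>, and the limit 0 is preserved.\<close>

lemma quenches_at_rescale:
  fixes N :: "real \<Rightarrow> real"
  assumes T: "0 < T" and D: "D \<noteq> {}" and u: "quenches_at D u T" and N: "continuous_on {0..} N"
    and eq: "\<And>i t x. i \<in> {1,2} \<Longrightarrow> (t, x) \<in> space_time D T \<Longrightarrow> u i t x = exp (N t) * z i t x"
  shows "quenches_at D z T"
proof -
  define r where "r = enn2real T"
  define m where "m = (\<lambda>(w :: nat \<Rightarrow> real \<Rightarrow> 'a \<Rightarrow> real) t.
    min (INF x\<in>closure D. \<bar>w 1 t x\<bar>) (INF x\<in>closure D. \<bar>w 2 t x\<bar>))"
  have fin: "T < \<infinity>" and lim: "(m u \<longlongrightarrow> 0) (at_left r)"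
    using u by (auto simp: quenches_at_def m_def r_def)
  have Tr: "T = ennreal r" and r: "r > 0"
    using T fin by (auto simp: r_def enn2real_positive_iff)
  have "isCont N r"
    using N r by (intro continuous_on_interior[OF N]) (auto simp: interior_real_atLeast)
  then have "(N \<longlongrightarrow> N r) (at_left r)"
    unfolding isCont_def by (rule tendsto_mono[OF at_le, rotated]) simp
  then have "((\<lambda>t. exp (- N t) * m u t) \<longlongrightarrow> exp (- N r) * 0) (at_left r)"
    by (intro tendsto_intros lim)
  \<comment> \<open>Restricting to \<open>0 < t\<close> places the whole closed slice in
    \<open>space_time\<close>, so the rescaling identity holds under the infimum over the
    closure.\<close>
  moreover have "\<forall>\<^sub>F t in at_left r. exp (- N t) * m u t = m z t"
    using eventually_at_left_real[OF r]
  proof eventually_elim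
    fix t assume t: "t \<in> {0<..<r}"
    have "(INF x\<in>closure D. \<bar>z i t x\<bar>) = exp (- N t) * (INF x\<in>closure D. \<bar>u i t x\<bar>)"
      if i: "i \<in> {1,2}" for i
    proof -
      have "(INF x\<in>closure D. \<bar>z i t x\<bar>) = (INF x\<in>closure D. exp (- N t) * \<bar>u i t x\<bar>)"
      proof (rule INF_cong[OF refl])
        fix x assume "x \<in> closure D"
        then have "(t, x) \<in> space_time D T" using t by (auto simp: space_time_def Tr ennreal_lessI)
        from eq[OF i this] show "\<bar>z i t x\<bar> = exp (- N t) * \<bar>u i t x\<bar>"
          by (simp add: abs_mult exp_minus)
      qed
      also have "\<dots> = exp (- N t) * (INF x\<in>closure D. \<bar>u i t x\<bar>)"
        using D by (intro INF_mult_left_real) (auto intro: bdd_belowI[of _ 0])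
      finally show ?thesis .
    qed
    from this[of 1] this[of 2] show "exp (- N t) * m u t = m z t"
      unfolding m_def by (simp add: min_def)
  qed
  ultimately have "(m z \<longlongrightarrow> 0) (at_left r)"
    by (simp add: Lim_transform_eventually)
  then show ?thesis using fin by (simp add: quenches_at_def m_def r_def)
qed

section \<open>The almost sure statement for both systems\<close>

theorem theorem4p2:
  fixes M :: "'w measure" and F :: "ennreal \<Rightarrow> 'w measure"
    and W B :: "real \<Rightarrow> 'w \<Rightarrow> real" and H :: real
    and D :: "'a::euclidean_space set" and \<nu> :: "'a \<Rightarrow> 'a" and \<beta> :: real
    and lam k \<rho> :: "nat \<Rightarrow> nat \<Rightarrow> real" and f g :: "nat \<Rightarrow> 'a \<Rightarrow> real"
    and chi ltilde ksq E0 :: real and \<psi> :: "'a \<Rightarrow> real"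
    and \<tau>star \<tau>q :: "'w \<Rightarrow> ennreal"
    and v :: "'w \<Rightarrow> nat \<Rightarrow> real \<Rightarrow> 'a \<Rightarrow> real"
  assumes domain: "bounded_smooth_domain D" and normal: "outward_unit_normal D \<nu>"
    and constants: "\<beta> > 0" "\<And>i m. i \<in> {1,2} \<Longrightarrow> m \<in> {1,2} \<Longrightarrow> lam i m > 0 \<and> k i m > 0"
    and prob: "filtered_prob_space M F"
    and BM: "brownian_motion M F W"
    and fBM: "fractional_brownian_motion M F H B" and Hurst: "1/2 < H" "H < 1"
    and data: "\<And>i. i \<in> {1,2} \<Longrightarrow>
                 C_on 2 (f i) D \<and> (\<forall>x\<in>D. 0 \<le> f i x \<and> f i x < 1) \<and> (\<exists>x\<in>D. f i x \<noteq> 0)"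
    and g_def: "\<And>i x. i \<in> {1,2} \<Longrightarrow> x \<in> D \<Longrightarrow> g i x = 1 - f i x"
    and eigen: "principal_eigenpair D \<nu> \<beta> chi \<psi>"
    and rho: "k 2 1 + 2 * k 1 1 = 3 * k 1 1" "\<rho> 1 1 = 3 * k 1 1"
             "k 2 2 + 2 * k 1 2 = 3 * k 1 2" "\<rho> 1 2 = 3 * k 1 2"
             "k 1 1 + 2 * k 2 1 = 3 * k 2 1" "\<rho> 2 1 = 3 * k 2 1"
             "k 1 2 + 2 * k 2 2 = 3 * k 2 2" "\<rho> 2 2 = 3 * k 2 2"
    and ltilde_def: "ltilde = min (lam 1 1 + lam 2 2) (lam 1 2 + lam 2 1)"
    and ksq_def: "ksq = min ((k 1 1)\<^sup>2 / 2) ((k 2 1)\<^sup>2 / 2)"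
    and E0_def: "E0 = (LINT x:D|lborel. (g 1 x + g 2 x) * \<psi> x)"
    and taustar_def: "\<And>\<omega>. \<tau>star \<omega> = Inf {ennreal t | t. 0 \<le> t \<and>
          (LINT s:{0..t}|lborel.
             min (exp (\<rho> 1 1 * W s \<omega> + \<rho> 1 2 * B s \<omega>)) (exp (\<rho> 2 1 * W s \<omega> + \<rho> 2 2 * B s \<omega>))
             * exp (3 * (chi + ksq) * s))
          \<ge> E0 ^ 3 / (12 * ltilde)}"
    and solution: "weak_solution_V M W B D \<nu> \<beta> lam k g \<tau>q v"
    and quenching: "is_quenching_time M F D v \<tau>q"
  shows "(AE \<omega> in M. \<tau>star \<omega> < \<infinity> \<longrightarrow> quenches_at D (v \<omega>) (\<tau>q \<omega>) \<and> \<tau>q \<omega> \<le> \<tau>star \<omega>) \<and>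
    (\<forall>z. weak_solution_Z M F W B D \<nu> \<beta> lam k g \<tau>q z \<and>
         (AE \<omega> in M. \<forall>i\<in>{1,2}. \<forall>(t, x)\<in>space_time D (\<tau>q \<omega>).
            v \<omega> i t x = exp (mixed_noise k W B \<omega> i t) * z \<omega> i t x) \<longrightarrow>
       (AE \<omega> in M. \<tau>star \<omega> < \<infinity> \<longrightarrow> quenches_at D (z \<omega>) (\<tau>q \<omega>) \<and> \<tau>q \<omega> \<le> \<tau>star \<omega>))"
proof -
  define N where "N = (\<lambda>\<omega>. mixed_noise k W B \<omega> 1)"
  have k: "k 2 1 = k 1 1" "k 2 2 = k 1 2" using rho by simp_all
  have N_eq: "mixed_noise k W B \<omega> i = N \<omega>" if "i \<in> {1,2}" for \<omega> i
    using that k by (auto simp: N_def mixed_noise_def fun_eq_iff)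
  have ksq: "(k i 1)\<^sup>2 / 2 = ksq" if "i \<in> {1,2}" for i
    using that k by (auto simp: ksq_def)
  have D: "open D" "connected D" "D \<noteq> {}" "bounded D"
    using domain by (auto simp: bounded_smooth_domain_def)
  have psi_test: "\<psi> \<in> robin_test_functions D \<nu> \<beta>"
    and lap: "\<And>x. x \<in> D \<Longrightarrow> laplacian \<psi> x = - chi * \<psi> x"
    and psi: "\<And>x. x \<in> D \<Longrightarrow> \<psi> x > 0" "(LINT x:D|lborel. \<psi> x) = 1"
    using eigen by (auto simp: principal_eigenpair_def robin_eigenpair_def minus_equation_iff)
  obtain U where "closure D \<subseteq> U" "C_on 2 \<psi> U"
    using psi_test by (auto simp: robin_test_functions_def C2_closure_def)
  then have psi_cont: "continuous_on (closure D) \<psi>"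
    by (metis C_on_Suc_imp_continuous_on continuous_on_subset numeral_2_eq_2)
  have g_cont: "continuous_on D (g i)" if "i \<in> {1,2}" for i
  proof -
    have "continuous_on D (f i)"
      using data[OF that] by (metis C_on_Suc_imp_continuous_on numeral_2_eq_2)
    then have "continuous_on D (\<lambda>x. 1 - f i x)" by (intro continuous_intros)
    then show ?thesis by (subst continuous_on_cong[OF refl g_def[OF that]])
  qed
  have lt: "ltilde > 0" using constants by (simp add: ltilde_def add_pos_pos)

  have W_cont: "AE \<omega> in M. continuous_on {0..} (\<lambda>t. W t \<omega>)"
    using BM by (auto simp: brownian_motion_def)
  have B_cont: "AE \<omega> in M. continuous_on {0..} (\<lambda>t. B t \<omega>)"
    using fBM by (auto simp: fractional_brownian_motion_def)
  have N_cont: "AE \<omega> in M. continuous_on {0..} (N \<omega>)"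
    using W_cont B_cont unfolding N_def mixed_noise_def
    by eventually_elim (intro continuous_intros)
  have path: "AE \<omega> in M. local_path D g (\<tau>q \<omega>) (v \<omega>)"
    using solution by (simp add: weak_solution_V_def)
  have weak: "AE \<omega> in M. \<forall>t. 0 \<le> t \<and> ennreal t < \<tau>q \<omega> \<longrightarrow>
      (LINT x:D|lborel. v \<omega> i t x * \<psi> x) = (LINT x:D|lborel. g i x * \<psi> x)
       - (LINT s:{0..t}|lborel. (chi + ksq) * (LINT x:D|lborel. v \<omega> i s x * \<psi> x))
       - lam i 1 * (LINT s:{0..t}|lborel. exp (3 * N \<omega> s) * (LINT x:D|lborel. 1 / (v \<omega> i s x)\<^sup>2 * \<psi> x))
       - lam i 2 * (LINT s:{0..t}|lborel. exp (3 * N \<omega> s) * (LINT x:D|lborel. 1 / (v \<omega> (3 - i) s x)\<^sup>2 * \<psi> x))"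
    if i: "i \<in> {1,2}" for i
  proof -
    \<comment> \<open>The eigenvalue equation turns the operator applied to \<open>\<psi>\<close>
      into multiplication by \<open>- (chi + ksq)\<close>, where \<open>ksq\<close> is the common
      value of \<open>(k i 1)^2 / 2\<close>.\<close>
    have drift: "(LINT x:D|lborel. v \<omega> i s x * (laplacian \<psi> x - (k i 1)\<^sup>2 / 2 * \<psi> x)) =
        - ((chi + ksq) * (LINT x:D|lborel. v \<omega> i s x * \<psi> x))" for \<omega> s
    proof -
      have "(LINT x:D|lborel. v \<omega> i s x * (laplacian \<psi> x - (k i 1)\<^sup>2 / 2 * \<psi> x)) =
          (LINT x:D|lborel. - (chi + ksq) * (v \<omega> i s x * \<psi> x))"
        unfolding ksq[OF i] using D(1)
        by (intro set_lebesgue_integral_cong) (auto simp: lap algebra_simps)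
      then show ?thesis by (simp only: set_integral_mult_right minus_mult_left)
    qed
    have j: "3 - i \<in> {1,2}" using i by auto
    have neg: "(LINT s:{0..t}|lborel. - w s) = - (LINT s:{0..t}|lborel. w s)" for t :: real and w :: "real \<Rightarrow> real"
      by (simp add: set_lebesgue_integral_def)
    have noise: "N \<omega> s + 2 * N \<omega> s = 3 * N \<omega> s" for \<omega> s by simp
    have "AE \<omega> in M. \<forall>t. 0 \<le> t \<and> ennreal t < \<tau>q \<omega> \<longrightarrow>
          (LINT x:D|lborel. v \<omega> i t x * \<psi> x) =
            (LINT x:D|lborel. g i x * \<psi> x)
            + (LINT s:{0..t}|lborel. LINT x:D|lborel. v \<omega> i s x * (laplacian \<psi> x - (k i 1)\<^sup>2 / 2 * \<psi> x))
            - lam i 1 * (LINT s:{0..t}|lborel. exp (3 * mixed_noise k W B \<omega> i s) *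
                (LINT x:D|lborel. 1 / (v \<omega> i s x)\<^sup>2 * \<psi> x))
            - lam i 2 * (LINT s:{0..t}|lborel.
                exp (mixed_noise k W B \<omega> i s + 2 * mixed_noise k W B \<omega> (3 - i) s) *
                (LINT x:D|lborel. 1 / (v \<omega> (3 - i) s x)\<^sup>2 * \<psi> x))"
      using solution i psi_test unfolding weak_solution_V_def by blast
    then show ?thesis
      unfolding drift N_eq[OF i] N_eq[OF j] noise neg by simp
  qed

  \<comment> \<open>This holds also where \<open>\<tau>star\<close> is infinite: it suffices that
    every time at which the threshold is reached is at least \<open>\<tau>q\<close>.\<close>
  have before: "AE \<omega> in M. \<tau>q \<omega> \<le> \<tau>star \<omega>"
    using path N_cont weak[of 1, simplified] weak[of 2, simplified]
  proof eventually_elim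
    case (elim \<omega>)
    show ?case unfolding taustar_def
    proof (rule Inf_greatest, rule ccontr)
      fix y
      assume "y \<in> {ennreal t | t. 0 \<le> t \<and> (LINT s:{0..t}|lborel.
             min (exp (\<rho> 1 1 * W s \<omega> + \<rho> 1 2 * B s \<omega>)) (exp (\<rho> 2 1 * W s \<omega> + \<rho> 2 2 * B s \<omega>))
             * exp (3 * (chi + ksq) * s)) \<ge> E0 ^ 3 / (12 * ltilde)}"
      then obtain t where y: "y = ennreal t" and t: "0 \<le> t"
        and ge: "E0 ^ 3 / (12 * ltilde) \<le> (LINT s:{0..t}|lborel.
             min (exp (\<rho> 1 1 * W s \<omega> + \<rho> 1 2 * B s \<omega>)) (exp (\<rho> 2 1 * W s \<omega> + \<rho> 2 2 * B s \<omega>))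
             * exp (3 * (chi + ksq) * s))"
        by blast
      assume "\<not> \<tau>q \<omega> \<le> y"
      then have lt_q: "ennreal t < \<tau>q \<omega>" by (simp add: y)
      \<comment> \<open>Equal coefficient rows make both exponents equal to
        \<open>3 * N \<omega> s\<close>, so the minimum is the exponential in the energy
        estimate.\<close>
      have min_eq: "min (exp (\<rho> 1 1 * W s \<omega> + \<rho> 1 2 * B s \<omega>)) (exp (\<rho> 2 1 * W s \<omega> + \<rho> 2 2 * B s \<omega>))
          = exp (3 * N \<omega> s)" for s
        using rho k by (simp add: N_def mixed_noise_def algebra_simps)
      define I where "I = (LINT s:{0..t}|lborel. exp (3 * N \<omega> s) * exp (3 * (chi + ksq) * s))"
      have "24 * ltilde * I < E0 ^ 3"
        unfolding ltilde_def E0_def I_def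
      proof (rule energy_bound[OF D psi_cont psi g_cont _ _ elim(1,2) _ t lt_q])
        show "0 < g i x \<and> g i x \<le> 1" if "i \<in> {1,2}" "x \<in> D" for i x
          using data[OF that(1)] g_def[OF that] that(2) by auto
        show "lam i m > 0" if "i \<in> {1,2}" "m \<in> {1,2}" for i m
          using constants(2)[OF that] by simp
      qed (use elim(3,4) in auto)
      \<comment> \<open>Reaching the threshold at \<open>t\<close> gives this bound with 12, while
        the energy estimate gives the strict reverse bound with 24. Together they would make
        \<open>ltilde * I\<close> negative.\<close>
      moreover have "E0 ^ 3 \<le> 12 * ltilde * I"
        using ge lt unfolding min_eq I_def[symmetric] by (simp add: field_simps)
      moreover have "ltilde * I \<ge> 0"
        using lt unfolding I_def set_lebesgue_integral_def by (intro mult_nonneg_nonneg integral_nonneg_AE) auto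
      ultimately show False by simp
    qed
  qed
  have quench: "AE \<omega> in M. \<tau>q \<omega> < \<infinity> \<longrightarrow> quenches_at D (v \<omega>) (\<tau>q \<omega>)"
    using quenching by (simp add: is_quenching_time_def)
  show ?thesis
  proof (intro conjI allI impI)
    show "AE \<omega> in M. \<tau>star \<omega> < \<infinity> \<longrightarrow> quenches_at D (v \<omega>) (\<tau>q \<omega>) \<and> \<tau>q \<omega> \<le> \<tau>star \<omega>"
      \<comment> \<open>Finiteness of \<open>\<tau>q\<close> follows from
        \<open>\<tau>q \<le> \<tau>star\<close>; the defining property of the quenching time then
        supplies the limit.\<close>
      using before quench by eventually_elim (auto intro: le_less_trans)
    fix z
    assume z: "weak_solution_Z M F W B D \<nu> \<beta> lam k g \<tau>q z \<and>
         (AE \<omega> in M. \<forall>i\<in>{1,2}. \<forall>(t, x)\<in>space_time D (\<tau>q \<omega>).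
            v \<omega> i t x = exp (mixed_noise k W B \<omega> i t) * z \<omega> i t x)"
    show "AE \<omega> in M. \<tau>star \<omega> < \<infinity> \<longrightarrow> quenches_at D (z \<omega>) (\<tau>q \<omega>) \<and> \<tau>q \<omega> \<le> \<tau>star \<omega>"
      using before quench path N_cont conjunct2[OF z]
    proof eventually_elim
      case (elim \<omega>)
      show ?case
      proof (intro impI conjI elim(1))
        assume "\<tau>star \<omega> < \<infinity>"
        with elim(1) have "\<tau>q \<omega> < \<infinity>" by (rule le_less_trans)
        with elim(2) have quench_v: "quenches_at D (v \<omega>) (\<tau>q \<omega>)" by simp
        have pos: "0 < \<tau>q \<omega>" using elim(3) by (simp add: local_path_def)
        show "quenches_at D (z \<omega>) (\<tau>q \<omega>)"
        proof (rule quenches_at_rescale[OF pos D(3) quench_v elim(4)])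
          fix i :: nat and t x
          assume i: "i \<in> {1,2}" and tx: "(t, x) \<in> space_time D (\<tau>q \<omega>)"
          have "v \<omega> i t x = exp (mixed_noise k W B \<omega> i t) * z \<omega> i t x"
            using bspec[OF bspec[OF elim(5) i] tx] by simp
          then show "v \<omega> i t x = exp (N \<omega> t) * z \<omega> i t x" by (simp only: N_eq[OF i])
        qed
      qed
    qed
  qed
qed

end
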